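(* Let $(\mathfrak g=\mathfrak h\oplus\mathfrak m,g)$ be a naturally reductive decomposition with $\mathfrak g$ semisimple and let $\mathfrak m\perp\mathfrak h$ with respect to some $\mathrm{ad}(\mathfrak g)$-invariant non-degenerate symmetric bilinear form $\overline g$ on $\mathfrak g$ such that $\overline g|_{\mathfrak m\times\mathfrak m}=g$. Let $(T,R)$ be its infinitesimal model. The following hold: (i) if $[\mathfrak m,\mathfrak m]_{\mathfrak h}=\mathfrak h$, then $\mathfrak g$ is the transvection algebra of $(T,R)$; (ii) if $\mathfrak g$ is simple, then $[\mathfrak m,\mathfrak m]_{\mathfrak h}=\mathfrak h$, and by (i) the transvection algebra is equal to $\mathfrak g$; (iii) if the reductive decomposition is effective, then $[\mathfrak m,\mathfrak m]_{\mathfrak h}=\mathfrak h$ and $\mathfrak g$ is the transvection algebra.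
   Context: Lie algebras are real and finite-dimensional. A naturally reductive decomposition $(\mathfrak g=\mathfrak h\oplus\mathfrak m,g)$ is a Lie algebra $\mathfrak g$ with a subalgebra $\mathfrak h$ (the isotropy algebra), a complement $\mathfrak m$ of $\mathfrak h$ and a metric (inner product) $g$ on $\mathfrak m$ such that $[\mathfrak h,\mathfrak m]\subset\mathfrak m$, $g$ is $\mathrm{ad}(\mathfrak h)$-invariant (so $\mathrm{ad}:\mathfrak h\to\mathfrak{so}(\mathfrak m)$), and $g([x,y]_{\mathfrak m},z)=-g(y,[x,z]_{\mathfrak m})$ for all $x,y,z\in\mathfrak m$; subscripts denote components in $\mathfrak g=\mathfrak h\oplus\mathfrak m$, and $[\mathfrak m,\mathfrak m]_{\mathfrak h}$ is the span of the $[x,y]_{\mathfrak h}$ with $x,y\in\mathfrak m$. Its infinitesimal model $(T,R)$ is given by $T(x,y)=-[x,y]_{\mathfrak m}$ and $R(x,y)=-\mathrm{ad}([x,y]_{\mathfrak h})\in\mathfrak{so}(\mathfrak m)$ for $x,y\in\mathfrak m$. The decomposition is effective if $\mathrm{ad}:\mathfrak h\to\mathfrak{so}(\mathfrak m)$ is injective, and $\mathfrak g$ is the transvection algebra if the decomposition is effective and $\mathrm{im}(R)=\mathrm{ad}(\mathfrak h)$ (here $\mathrm{im}(R)$ is the span of all $R(x,y)$).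
   Formalization: Part (ii) is stated with the additional assumption that 𝔪 is nonzero; for 𝔪 = 0 and 𝔥 = 𝔤 simple, all hypotheses hold but [𝔪,𝔪]_𝔥 = 0 ≠ 𝔥. *)

theory Defs
  imports "HOL-Analysis.Analysis" "HOL-Library.Function_Algebras"
begin

section \<open>Lie algebras\<close>

text \<open>The underlying vector space is the whole type \<open>'g\<close>; the bracket is the parameter \<open>br\<close>.\<close>

locale lie_algebra =
  fixes br :: "'g::real_vector \<Rightarrow> 'g \<Rightarrow> 'g"
  assumes finite_dim: "\<exists>B::'g set. finite B \<and> span B = UNIV"
    and bilinear_br: "bilinear br"
    and br_self: "br x x = 0"
    and jacobi: "br x (br y z) + br y (br z x) + br z (br x y) = 0"

definition lie_subalgebra :: "('g::real_vector \<Rightarrow> 'g \<Rightarrow> 'g) \<Rightarrow> 'g set \<Rightarrow> bool" where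
  "lie_subalgebra br S \<longleftrightarrow> subspace S \<and> (\<forall>x\<in>S. \<forall>y\<in>S. br x y \<in> S)"

definition lie_ideal :: "('g::real_vector \<Rightarrow> 'g \<Rightarrow> 'g) \<Rightarrow> 'g set \<Rightarrow> bool" where
  "lie_ideal br I \<longleftrightarrow> subspace I \<and> (\<forall>x. \<forall>y\<in>I. br x y \<in> I)"

definition derived :: "('g::real_vector \<Rightarrow> 'g \<Rightarrow> 'g) \<Rightarrow> 'g set \<Rightarrow> 'g set" where
  "derived br S = span {br x y | x y. x \<in> S \<and> y \<in> S}"

definition lie_solvable :: "('g::real_vector \<Rightarrow> 'g \<Rightarrow> 'g) \<Rightarrow> 'g set \<Rightarrow> bool" where
  "lie_solvable br S \<longleftrightarrow> (\<exists>n. (derived br ^^ n) S = {0})"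

text \<open>The radical vanishes. With this convention the zero Lie algebra is semisimple.\<close>

definition lie_semisimple :: "('g::real_vector \<Rightarrow> 'g \<Rightarrow> 'g) \<Rightarrow> bool" where
  "lie_semisimple br \<longleftrightarrow> (\<forall>I. lie_ideal br I \<and> lie_solvable br I \<longrightarrow> I = {0})"

definition lie_simple :: "('g::real_vector \<Rightarrow> 'g \<Rightarrow> 'g) \<Rightarrow> bool" where
  "lie_simple br \<longleftrightarrow>
     (\<exists>x y. br x y \<noteq> 0) \<and> (\<forall>I. lie_ideal br I \<longrightarrow> I = {0} \<or> I = UNIV)"

section \<open>Forms\<close>

definition inner_product_on :: "'g::real_vector set \<Rightarrow> ('g \<Rightarrow> 'g \<Rightarrow> real) \<Rightarrow> bool" where
  "inner_product_on m g \<longleftrightarrow>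
     (\<forall>x\<in>m. \<forall>y\<in>m. \<forall>z\<in>m. g (x + y) z = g x z + g y z) \<and>
     (\<forall>c. \<forall>x\<in>m. \<forall>y\<in>m. g (c *\<^sub>R x) y = c * g x y) \<and>
     (\<forall>x\<in>m. \<forall>y\<in>m. g x y = g y x) \<and>
     (\<forall>x\<in>m. x \<noteq> 0 \<longrightarrow> g x x > 0)"

definition invariant_form ::
    "('g::real_vector \<Rightarrow> 'g \<Rightarrow> 'g) \<Rightarrow> ('g \<Rightarrow> 'g \<Rightarrow> real) \<Rightarrow> bool" where
  "invariant_form br b \<longleftrightarrow>
     bilinear b \<and> (\<forall>x y. b x y = b y x) \<and> (\<forall>x. (\<forall>y. b x y = 0) \<longrightarrow> x = 0) \<and>
     (\<forall>z x y. b (br z x) y = - b x (br z y))"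

section \<open>Naturally reductive decompositions\<close>

text \<open>The component of \<open>v\<close> in \<open>S\<close> with respect to \<open>S \<oplus> S'\<close>;
  unique, hence meaningful, only when \<open>S\<close> and \<open>S'\<close> are complementary subspaces.\<close>

definition component :: "'g::real_vector set \<Rightarrow> 'g set \<Rightarrow> 'g \<Rightarrow> 'g" where
  "component S S' v = (THE a. a \<in> S \<and> v - a \<in> S')"

locale naturally_reductive_decomposition = lie_algebra br
  for br :: "'g::real_vector \<Rightarrow> 'g \<Rightarrow> 'g" +
  fixes h m :: "'g set" and g :: "'g \<Rightarrow> 'g \<Rightarrow> real"
  assumes subalgebra_h: "lie_subalgebra br h"
    and subspace_m: "subspace m"
    and complement_Int: "h \<inter> m = {0}"
    and complement_sum: "\<forall>v. \<exists>a\<in>h. \<exists>x\<in>m. v = a + x"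
    and inner_product_g: "inner_product_on m g"
    and reductive: "\<forall>a\<in>h. \<forall>x\<in>m. br a x \<in> m"
    and ad_invariant: "\<forall>a\<in>h. \<forall>x\<in>m. \<forall>y\<in>m. g (br a x) y = - g x (br a y)"
    and naturally_reductive:
      "\<forall>x\<in>m. \<forall>y\<in>m. \<forall>z\<in>m.
         g (component m h (br x y)) z = - g y (component m h (br x z))"

definition mm_h ::
    "('g::real_vector \<Rightarrow> 'g \<Rightarrow> 'g) \<Rightarrow> 'g set \<Rightarrow> 'g set \<Rightarrow> 'g set" where
  "mm_h br h m = span {component h m (br x y) | x y. x \<in> m \<and> y \<in> m}"

text \<open>An endomorphism of the subspace \<open>m\<close> is encoded as a function on \<open>'g\<close> vanishing outside
  \<open>m\<close>, so that equality of functions is equality of endomorphisms of \<open>m\<close>, and so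
  that these functions are closed under pointwise linear combinations.\<close>

definition ad_on ::
    "('g::real_vector \<Rightarrow> 'g \<Rightarrow> 'g) \<Rightarrow> 'g set \<Rightarrow> 'g \<Rightarrow> ('g \<Rightarrow> 'g)" where
  "ad_on br m a = (\<lambda>z. if z \<in> m then br a z else 0)"

text \<open>Only the values of \<open>T\<close> and \<open>R\<close> on \<open>m \<times> m\<close> are relevant.\<close>

definition infinitesimal_model ::
    "('g::real_vector \<Rightarrow> 'g \<Rightarrow> 'g) \<Rightarrow> 'g set \<Rightarrow> 'g set \<Rightarrow>
     ('g \<Rightarrow> 'g \<Rightarrow> 'g) \<Rightarrow> ('g \<Rightarrow> 'g \<Rightarrow> ('g \<Rightarrow> 'g)) \<Rightarrow> bool" where
  "infinitesimal_model br h m T R \<longleftrightarrow>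
     (\<forall>x\<in>m. \<forall>y\<in>m.
        T x y = - component m h (br x y) \<and>
        R x y = - ad_on br m (component h m (br x y)))"

text \<open>Functions into a real vector space are not an instance of the class \<open>real_vector\<close>;
  \<open>fun_space.span\<close> is the linear span for pointwise operations.\<close>

global_interpretation fun_space: vector_space
  "\<lambda>(c::real) (f :: 'a \<Rightarrow> 'b::real_vector) x. c *\<^sub>R f x"
  by standard (auto simp: fun_eq_iff scaleR_add_left scaleR_add_right)

definition im_curvature ::
    "'g::real_vector set \<Rightarrow> ('g \<Rightarrow> 'g \<Rightarrow> ('g \<Rightarrow> 'g)) \<Rightarrow> ('g \<Rightarrow> 'g) set" where
  "im_curvature m R = fun_space.span {R x y | x y. x \<in> m \<and> y \<in> m}"

definition effective ::
    "('g::real_vector \<Rightarrow> 'g \<Rightarrow> 'g) \<Rightarrow> 'g set \<Rightarrow> 'g set \<Rightarrow> bool" where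
  "effective br h m \<longleftrightarrow> inj_on (ad_on br m) h"

text \<open>The Lie algebra \<open>('g, br)\<close>, with the decomposition \<open>h \<oplus> m\<close> and the metric \<open>g\<close>,
  is the transvection algebra of \<open>(T, R)\<close>.\<close>

definition is_transvection_algebra ::
    "('g::real_vector \<Rightarrow> 'g \<Rightarrow> 'g) \<Rightarrow> 'g set \<Rightarrow> 'g set \<Rightarrow> ('g \<Rightarrow> 'g \<Rightarrow> real) \<Rightarrow>
     ('g \<Rightarrow> 'g \<Rightarrow> 'g) \<Rightarrow> ('g \<Rightarrow> 'g \<Rightarrow> ('g \<Rightarrow> 'g)) \<Rightarrow> bool" where
  "is_transvection_algebra br h m g T R \<longleftrightarrow>
     naturally_reductive_decomposition br h m g \<and> infinitesimal_model br h m T R \<and>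
     effective br h m \<and> im_curvature m R = ad_on br m ` h"

end

theory Submission
  imports Defs
begin

text \<open>The key is one computation with the invariant form: for \<open>a \<in> h\<close> and
  \<open>x, y \<in> m\<close>, \<open>gbar [a, x] y = gbar a [x, y] = gbar a [x, y]\<^sub>h\<close>. As \<open>gbar\<close> is definite on \<open>m\<close>,
  the elements of \<open>h\<close> that centralize \<open>m\<close> are exactly those orthogonal to \<open>[m, m]\<^sub>h\<close>
  (\<open>centralizes_m_iff\<close>). Since \<open>h\<close> acts effectively precisely when no nonzero element of it
  centralizes \<open>m\<close>, effectiveness and \<open>[m, m]\<^sub>h = h\<close> imply each other: if \<open>[m, m]\<^sub>h = h\<close>, a
  centralizing element is orthogonal to \<open>h\<close> and to \<open>m\<close>, hence zero by nondegeneracy; if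
  the action is effective, the subspace \<open>[m, m]\<^sub>h + m\<close> has trivial orthogonal complement, and in
  finite dimension it must then be everything.

  The curvature image is \<open>ad [m, m]\<^sub>h\<close>, so \<open>[m, m]\<^sub>h = h\<close> also gives the remaining
  condition on a transvection algebra. For simple algebras one uses that \<open>[m, m]\<^sub>h + m\<close>
  is an ideal, nonzero as soon as \<open>m\<close> is.\<close>

section \<open>Subspaces with trivial orthogonal complement\<close>

text \<open>For a basis \<open>B\<close> of \<open>W\<close>, the kernel of the endomorphism \<open>v \<mapsto> \<Sum>b\<in>B. \<beta> v b \<cdot> b\<close> is the
  orthogonal complement of \<open>W\<close> and its range lies in \<open>W\<close>; if the former is trivial, the
  endomorphism is injective, hence surjective.\<close>

lemma subspace_eq_UNIV_if_trivial_orthogonal_complement: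
  fixes \<beta> :: "'v::real_vector \<Rightarrow> 'v \<Rightarrow> real" and W :: "'v set"
  assumes fin: "\<exists>B::'v set. finite B \<and> span B = UNIV"
    and bil: "bilinear \<beta>" and W: "subspace W"
    and triv: "\<And>v. (\<forall>w\<in>W. \<beta> v w = 0) \<Longrightarrow> v = 0"
  shows "W = UNIV"
proof -
  obtain C :: "'v set" where C: "finite C" "span C = UNIV" using fin by blast
  obtain E :: "'v set" where E: "E \<subseteq> C" "independent E" "C \<subseteq> span E"
    using maximal_independent_subset by blast
  have finE: "finite E" using E(1) C(1) finite_subset by blast
  have spE: "span E = UNIV" using E(3) C(2) by (metis span_mono span_span top.extremum_uniqueI)
  interpret fd: finite_dimensional_vector_space scaleR E
    by unfold_locales (use finE E(2) spE in \<open>auto simp: dependent_raw_def span_raw_def\<close>)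
  obtain B where B: "B \<subseteq> W" "independent B" "W \<subseteq> span B"
    using maximal_independent_subset by blast
  have finB: "finite B"
    using fd.finiteI_independent B(2) by (simp add: dependent_raw_def)
  have lin1: "linear (\<beta> v)" and lin2: "linear (\<lambda>v. \<beta> v w)" for v w
    using bil by (auto simp: bilinear_def)
  define \<Phi> where "\<Phi> v = (\<Sum>b\<in>B. \<beta> v b *\<^sub>R b)" for v
  have lin: "linear \<Phi>"
    unfolding \<Phi>_def
    by (intro linear_compose_sum ballI linearI)
       (simp_all add: linear_add[OF lin2] linear_scale[OF lin2] scaleR_left_distrib)
  have "v = 0" if "\<Phi> v = 0" for v
  proof (rule triv, rule ballI)
    have "\<forall>b\<in>B. \<beta> v b = 0"
      using that B(2) finB independentD[of B B "\<beta> v"] by (auto simp: \<Phi>_def)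
    moreover fix w assume "w \<in> W"
    ultimately show "\<beta> v w = 0"
      using linear_eq_0_on_span[OF lin1, of B v w] B(3) by blast
  qed
  then have "inj \<Phi>" using linear_injective_0[OF lin] by blast
  then have "surj \<Phi>" using fd.linear_inj_imp_surj lin by (simp add: linear_def)
  moreover have "\<Phi> v \<in> W" for v
    unfolding \<Phi>_def using B(1) W by (intro subspace_sum) (auto intro: subspace_scale)
  ultimately show ?thesis by (metis UNIV_eq_I surjD)
qed

section \<open>Components and the isotropy action\<close>

context naturally_reductive_decomposition
begin

lemma subspace_h: "subspace h"
  using subalgebra_h by (simp add: lie_subalgebra_def)

lemma h_Int_m_zero: "a \<in> h \<Longrightarrow> a \<in> m \<Longrightarrow> a = 0"
  using complement_Int by blast

lemma br_add_left: "br (x + y) z = br x z + br y z"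
  and br_add_right: "br z (x + y) = br z x + br z y"
  and br_scale_left: "br (c *\<^sub>R x) z = c *\<^sub>R br x z"
  and br_minus_left: "br (- x) z = - br x z"
  and br_minus_right: "br z (- x) = - br z x"
  and br_zero_left: "br 0 z = 0"
  using bilinear_br
  by (simp_all add: bilinear_ladd bilinear_radd bilinear_lmul bilinear_lneg bilinear_rneg
      bilinear_lzero)

lemma linear_br: "linear (br z)"
  using bilinear_br by (simp add: bilinear_def)

lemma br_anticomm: "br x y = - br y x"
proof -
  have "br (x + y) (x + y) = br x y + br y x"
    using br_self[of x] br_self[of y] by (simp add: br_add_left br_add_right)
  then have "br x y + br y x = 0" using br_self[of "x + y"] by simp
  then show ?thesis by (simp add: eq_neg_iff_add_eq_0)
qed

lemma ad_derivation: "br a (br x y) = br (br a x) y + br x (br a y)"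
proof -
  have "br x (br y a) = - br x (br a y)" "br y (br a x) = - br (br a x) y"
    using br_anticomm[of y a] br_anticomm[of y "br a x"] by (simp_all add: br_minus_right)
  then show ?thesis using jacobi[of a x y] by (simp add: algebra_simps)
qed

lemma component_h_eqI: "a \<in> h \<Longrightarrow> v - a \<in> m \<Longrightarrow> component h m v = a"
  unfolding component_def
proof (rule the_equality)
  fix b assume a: "a \<in> h" "v - a \<in> m" and b: "b \<in> h \<and> v - b \<in> m"
  have "b - a \<in> h" using a b subspace_h subspace_diff by blast
  moreover have "b - a \<in> m"
    using subspace_diff[OF subspace_m, of "v - a" "v - b"] a b by simp
  ultimately show "b = a" using h_Int_m_zero by fastforce
qed auto

lemma component_h: "component h m v \<in> h" "v - component h m v \<in> m"
proof -
  obtain a x where "a \<in> h" "x \<in> m" "v = a + x" using complement_sum by blast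
  then have "component h m v = a" "a \<in> h" "v - a \<in> m" by (auto intro: component_h_eqI)
  then show "component h m v \<in> h" "v - component h m v \<in> m" by simp_all
qed

lemma br_h_h: "a \<in> h \<Longrightarrow> b \<in> h \<Longrightarrow> br a b \<in> h"
  using subalgebra_h by (simp add: lie_subalgebra_def)

text \<open>Both summands are stable under the action of \<open>h\<close>, so projecting commutes with it.\<close>

lemma component_h_br: "a \<in> h \<Longrightarrow> component h m (br a v) = br a (component h m v)"
proof (rule component_h_eqI)
  assume a: "a \<in> h"
  then show "br a (component h m v) \<in> h" using component_h(1) br_h_h by blast
  have "br a (v - component h m v) \<in> m" using a component_h(2) reductive by blast
  then show "br a v - br a (component h m v) \<in> m" by (simp add: linear_diff[OF linear_br])
qed

lemma component_h_add: "component h m (v + w) = component h m v + component h m w"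
proof (rule component_h_eqI)
  show "component h m v + component h m w \<in> h"
    using component_h(1) subspace_h subspace_add by blast
  show "v + w - (component h m v + component h m w) \<in> m"
    using subspace_add[OF subspace_m component_h(2) component_h(2), of v w]
    by (simp add: algebra_simps)
qed

lemma mm_h_subset: "mm_h br h m \<subseteq> h"
  unfolding mm_h_def by (rule span_minimal) (auto simp: component_h subspace_h)

lemma component_h_br_mem_mm_h: "x \<in> m \<Longrightarrow> y \<in> m \<Longrightarrow> component h m (br x y) \<in> mm_h br h m"
  unfolding mm_h_def by (rule span_base) blast

lemma subspace_mm_h: "subspace (mm_h br h m)"
  by (simp add: mm_h_def)

lemma br_h_mm_h:
  assumes "a \<in> h" "b \<in> mm_h br h m"
  shows "br a b \<in> mm_h br h m"
  using assms(2) unfolding mm_h_def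
proof (induction rule: span_induct)
  case base
  show ?case
    by (rule subspaceI) (auto simp: linear_0[OF linear_br] linear_add[OF linear_br]
        linear_scale[OF linear_br] intro: span_0 span_add span_scale)
next
  case (step b)
  then obtain x y where xy: "x \<in> m" "y \<in> m" and b: "b = component h m (br x y)" by blast
  have "br a b = component h m (br (br a x) y) + component h m (br x (br a y))"
    using assms(1) by (simp add: b ad_derivation[of a x y] flip: component_h_br component_h_add)
  then show ?case
    using xy assms(1) reductive component_h_br_mem_mm_h subspace_add[OF subspace_mm_h]
    by (simp flip: mm_h_def)
qed

lemma mm_h_eq_h_if_sum_eq_UNIV:
  assumes "{b + x | b x. b \<in> mm_h br h m \<and> x \<in> m} = UNIV"
  shows "mm_h br h m = h"
proof
  show "h \<subseteq> mm_h br h m"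
  proof
    fix a assume a: "a \<in> h"
    obtain b x where b: "b \<in> mm_h br h m" "x \<in> m" "a = b + x" using assms by blast
    have "component h m a = a" "component h m a = b"
      using a b mm_h_subset subspace_0[OF subspace_m] by (auto intro!: component_h_eqI)
    then show "a \<in> mm_h br h m" using b by simp
  qed
qed (rule mm_h_subset)

section \<open>The ideal generated by the complement\<close>

text \<open>Splitting an arbitrary element as \<open>a + y\<close> with \<open>a \<in> h\<close> and \<open>y \<in> m\<close>, the only bracket that
  mixes the summands is that of two elements of \<open>m\<close>, whose \<open>h\<close>-component lies in \<open>[m, m]\<^sub>h\<close>
  by definition; stability of \<open>[m, m]\<^sub>h\<close> under \<open>h\<close> is the derivation property.\<close>

lemma lie_ideal_mm_h_plus_m: "lie_ideal br {b + x | b x. b \<in> mm_h br h m \<and> x \<in> m}"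
proof -
  let ?k = "{b + x | b x. b \<in> mm_h br h m \<and> x \<in> m}"
  have sub: "subspace ?k"
    using subspace_sums[OF subspace_mm_h subspace_m] by (simp add: conj_commute)
  have mI: "x \<in> ?k" if "x \<in> m" for x
    using that subspace_0[OF subspace_mm_h] by (intro CollectI exI[of _ 0] exI[of _ x]) simp
  have hI: "b \<in> ?k" if "b \<in> mm_h br h m" for b
    using that subspace_0[OF subspace_m] by (intro CollectI exI[of _ b] exI[of _ 0]) simp
  have "br z (b + x) \<in> ?k" if bx: "b \<in> mm_h br h m" "x \<in> m" for z b x
  proof -
    obtain a y where z: "a \<in> h" "y \<in> m" "z = a + y" using complement_sum by blast
    have "br a b \<in> ?k" using br_h_mm_h z bx hI by blast
    moreover have "br a x \<in> ?k" using z bx reductive mI by blast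
    moreover have "br y b \<in> ?k"
    proof -
      have "br b y \<in> m" using z bx reductive mm_h_subset by blast
      then have "br y b \<in> m"
        using subspace_neg[OF subspace_m, of "br b y"] br_anticomm[of y b] by simp
      then show ?thesis by (rule mI)
    qed
    moreover have "br y x \<in> ?k"
      using component_h_br_mem_mm_h[OF z(2) bx(2)] component_h(2)[of "br y x"]
      by (intro CollectI exI[of _ "component h m (br y x)"]
          exI[of _ "br y x - component h m (br y x)"]) simp
    ultimately show ?thesis
      using subspace_add[OF sub] by (simp only: z br_add_left br_add_right)
  qed
  then show ?thesis using sub unfolding lie_ideal_def by blast
qed

lemma mm_h_eq_h_if_simple:
  assumes "lie_simple br" "m \<noteq> {0}"
  shows "mm_h br h m = h"
proof (rule mm_h_eq_h_if_sum_eq_UNIV)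
  obtain x where "x \<in> m" "x \<noteq> 0" using assms(2) subspace_0[OF subspace_m] by blast
  then have "x \<in> {b + x | b x. b \<in> mm_h br h m \<and> x \<in> m}"
    using subspace_0[OF subspace_mm_h] by (intro CollectI exI[of _ 0] exI[of _ x]) simp
  then show "{b + x | b x. b \<in> mm_h br h m \<and> x \<in> m} = UNIV"
    using assms(1) lie_ideal_mm_h_plus_m \<open>x \<noteq> 0\<close> unfolding lie_simple_def by blast
qed

section \<open>Effectiveness and the image of the curvature\<close>

lemma effective_iff:
  "effective br h m \<longleftrightarrow> (\<forall>a\<in>h. (\<forall>x\<in>m. br a x = 0) \<longrightarrow> a = 0)"
proof
  assume inj: "effective br h m"
  show "\<forall>a\<in>h. (\<forall>x\<in>m. br a x = 0) \<longrightarrow> a = 0"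
  proof (intro ballI impI)
    fix a assume a: "a \<in> h" "\<forall>x\<in>m. br a x = 0"
    then have "ad_on br m a = ad_on br m 0" by (simp add: ad_on_def br_zero_left fun_eq_iff)
    then show "a = 0"
      using inj a subspace_0[OF subspace_h] by (auto simp: effective_def inj_on_def)
  qed
next
  assume *: "\<forall>a\<in>h. (\<forall>x\<in>m. br a x = 0) \<longrightarrow> a = 0"
  show "effective br h m"
    unfolding effective_def
  proof (rule inj_onI)
    fix a b assume ab: "a \<in> h" "b \<in> h" "ad_on br m a = ad_on br m b"
    have "br (a - b) x = 0" if "x \<in> m" for x
      using fun_cong[OF ab(3), of x] that by (simp add: ad_on_def bilinear_lsub[OF bilinear_br])
    then have "a - b = 0" using * ab subspace_diff[OF subspace_h] by blast
    then show "a = b" by simp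
  qed
qed

text \<open>The isotropy action is linear in the acting element, so it carries the span defining
  \<open>[m, m]\<^sub>h\<close> to the span of the curvature operators. The sign in \<open>R\<close> is absorbed by exchanging the
  two arguments of the bracket.\<close>

lemma im_curvature_eq_ad_mm_h:
  assumes "infinitesimal_model br h m T R"
  shows "im_curvature m R = ad_on br m ` mm_h br h m"
proof -
  interpret ad: module_hom scaleR "\<lambda>(c::real) (f :: 'g \<Rightarrow> 'g) x. c *\<^sub>R f x" "ad_on br m"
    by unfold_locales (auto simp: ad_on_def br_add_left br_scale_left fun_eq_iff algebra_simps)
  have "R x y = ad_on br m (component h m (br y x))" if "x \<in> m" "y \<in> m" for x y
  proof -
    have "component h m (br y x) + component h m (br x y) = 0"
      using component_h_add[of "br y x" "br x y"] br_anticomm[of x y]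
        component_h_eqI[of 0 0] subspace_0[OF subspace_h] subspace_0[OF subspace_m] by simp
    then have "component h m (br y x) = - component h m (br x y)"
      by (simp add: eq_neg_iff_add_eq_0)
    then show ?thesis
      using assms that
      by (auto simp: infinitesimal_model_def ad_on_def fun_eq_iff br_minus_left)
  qed
  then have "{R x y | x y. x \<in> m \<and> y \<in> m} =
      ad_on br m ` {component h m (br x y) | x y. x \<in> m \<and> y \<in> m}"
    by (auto simp: image_iff) metis+
  then show ?thesis
    by (simp add: im_curvature_def mm_h_def ad.span_image span_raw_def)
qed

end

section \<open>Invariant forms adapted to the decomposition\<close>

locale form_adapted_decomposition = naturally_reductive_decomposition br h m g
  for br :: "'g::real_vector \<Rightarrow> 'g \<Rightarrow> 'g" and h m g +
  fixes gbar :: "'g \<Rightarrow> 'g \<Rightarrow> real"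
  assumes invariant: "invariant_form br gbar"
    and m_orthogonal_h: "\<forall>x\<in>m. \<forall>a\<in>h. gbar x a = 0"
    and gbar_on_m: "\<forall>x\<in>m. \<forall>y\<in>m. gbar x y = g x y"
begin

lemma bilinear_gbar: "bilinear gbar"
  and gbar_commute: "gbar x y = gbar y x"
  and gbar_nondegenerate: "(\<And>y. gbar x y = 0) \<Longrightarrow> x = 0"
  and gbar_invariant: "gbar (br z x) y = - gbar x (br z y)"
  using invariant unfolding invariant_form_def by blast+

lemma gbar_h_m: "a \<in> h \<Longrightarrow> x \<in> m \<Longrightarrow> gbar a x = 0"
  using m_orthogonal_h gbar_commute by metis

lemma linear_gbar: "linear (gbar v)"
  using bilinear_gbar by (simp add: bilinear_def)

lemma gbar_definite_on_m: "x \<in> m \<Longrightarrow> gbar x x = 0 \<Longrightarrow> x = 0"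
  using inner_product_g gbar_on_m unfolding inner_product_on_def by (metis less_irrefl)

lemma gbar_br_eq_component:
  assumes "a \<in> h" "x \<in> m" "y \<in> m"
  shows "gbar (br a x) y = gbar a (component h m (br x y))"
proof -
  have "gbar (br a x) y = - gbar (br x a) y"
    using br_anticomm[of a x] bilinear_lneg[OF bilinear_gbar] by simp
  also have "\<dots> = gbar a (br x y)" by (simp add: gbar_invariant)
  also have "\<dots> = gbar a (component h m (br x y)) + gbar a (br x y - component h m (br x y))"
    by (simp flip: bilinear_radd[OF bilinear_gbar])
  finally show ?thesis using gbar_h_m[OF assms(1) component_h(2)] by simp
qed

text \<open>By the previous identity, \<open>a\<close> is orthogonal to \<open>[m, m]\<^sub>h\<close> iff \<open>[a, m]\<close>, a subset of
  \<open>m\<close>, is orthogonal to \<open>m\<close>, which by definiteness means that it vanishes.\<close>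

lemma centralizes_m_iff:
  assumes "a \<in> h"
  shows "(\<forall>x\<in>m. br a x = 0) \<longleftrightarrow> (\<forall>b\<in>mm_h br h m. gbar a b = 0)"
proof
  assume *: "\<forall>x\<in>m. br a x = 0"
  show "\<forall>b\<in>mm_h br h m. gbar a b = 0"
    unfolding mm_h_def
  proof (rule ballI, rule linear_eq_0_on_span[OF linear_gbar])
    fix b assume "b \<in> {component h m (br x y) | x y. x \<in> m \<and> y \<in> m}"
    then show "gbar a b = 0"
      using gbar_br_eq_component[OF assms] * bilinear_lzero[OF bilinear_gbar] by fastforce
  qed
next
  assume *: "\<forall>b\<in>mm_h br h m. gbar a b = 0"
  show "\<forall>x\<in>m. br a x = 0"
  proof
    fix x assume x: "x \<in> m"
    then have "br a x \<in> m" using assms reductive by blast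
    then show "br a x = 0"
      using gbar_br_eq_component[OF assms x] * component_h_br_mem_mm_h[OF x]
      by (intro gbar_definite_on_m) auto
  qed
qed

text \<open>An element of \<open>h\<close> that centralizes \<open>m\<close> is orthogonal to \<open>[m, m]\<^sub>h = h\<close>, and to \<open>m\<close> anyway,
  hence it lies in the radical of the form.\<close>

lemma effective_if_mm_h_eq_h:
  assumes "mm_h br h m = h"
  shows "effective br h m"
  unfolding effective_iff
proof (intro ballI impI gbar_nondegenerate)
  fix a v assume a: "a \<in> h" "\<forall>x\<in>m. br a x = 0"
  obtain b x where v: "b \<in> h" "x \<in> m" "v = b + x" using complement_sum by blast
  have "gbar a b = 0" using a v assms centralizes_m_iff by blast
  then show "gbar a v = 0" using a v gbar_h_m by (simp add: bilinear_radd[OF bilinear_gbar])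
qed

text \<open>A vector orthogonal to \<open>[m, m]\<^sub>h + m\<close> has no \<open>m\<close>-component by definiteness, and its
  \<open>h\<close>-component centralizes \<open>m\<close>, so it vanishes when the action is effective.\<close>

lemma mm_h_eq_h_if_effective:
  assumes "effective br h m"
  shows "mm_h br h m = h"
proof (rule mm_h_eq_h_if_sum_eq_UNIV,
    rule subspace_eq_UNIV_if_trivial_orthogonal_complement[OF finite_dim bilinear_gbar])
  let ?k = "{b + x | b x. b \<in> mm_h br h m \<and> x \<in> m}"
  show "subspace ?k" by (rule subspace_sums[OF subspace_mm_h subspace_m])
  fix v assume perp: "\<forall>w\<in>?k. gbar v w = 0"
  have perp_m: "gbar v x = 0" if "x \<in> m" for x
    using perp that subspace_0[OF subspace_mm_h] by force
  have perp_mm_h: "gbar v b = 0" if "b \<in> mm_h br h m" for b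
    using perp that subspace_0[OF subspace_m] by force
  obtain a x where v: "a \<in> h" "x \<in> m" "v = a + x" using complement_sum by blast
  have "gbar x x = 0"
    using perp_m[OF v(2)] gbar_h_m[OF v(1,2)] by (simp add: v bilinear_ladd[OF bilinear_gbar])
  then have "x = 0" using v gbar_definite_on_m by blast
  then show "v = 0"
    using v perp_mm_h centralizes_m_iff assms by (auto simp: effective_iff)
qed

lemma is_transvection_algebra_if_mm_h_eq_h:
  assumes "mm_h br h m = h" "infinitesimal_model br h m T R"
  shows "is_transvection_algebra br h m g T R"
  using assms effective_if_mm_h_eq_h im_curvature_eq_ad_mm_h
    naturally_reductive_decomposition_axioms
  unfolding is_transvection_algebra_def by metis

end

section \<open>The decomposition as a transvection algebra\<close>

theorem lemma3p2:
  fixes br :: "'g::real_vector \<Rightarrow> 'g \<Rightarrow> 'g"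
    and h m :: "'g set"
    and g gbar :: "'g \<Rightarrow> 'g \<Rightarrow> real"
    and T :: "'g \<Rightarrow> 'g \<Rightarrow> 'g"
    and R :: "'g \<Rightarrow> 'g \<Rightarrow> ('g \<Rightarrow> 'g)"
  assumes "naturally_reductive_decomposition br h m g"
    and "lie_semisimple br"
    and "invariant_form br gbar"
    and "\<forall>x\<in>m. \<forall>a\<in>h. gbar x a = 0"
    and "\<forall>x\<in>m. \<forall>y\<in>m. gbar x y = g x y"
    and "infinitesimal_model br h m T R"
  shows "(mm_h br h m = h \<longrightarrow> is_transvection_algebra br h m g T R) \<and>
         (lie_simple br \<and> m \<noteq> {0} \<longrightarrow>
            mm_h br h m = h \<and> is_transvection_algebra br h m g T R) \<and>
         (effective br h m \<longrightarrow>
            mm_h br h m = h \<and> is_transvection_algebra br h m g T R)"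
proof -
  interpret form_adapted_decomposition br h m g gbar
    using assms(1,3-5)
    by (intro form_adapted_decomposition.intro form_adapted_decomposition_axioms.intro)
  show ?thesis
    using is_transvection_algebra_if_mm_h_eq_h[OF _ assms(6)] mm_h_eq_h_if_simple
      mm_h_eq_h_if_effective by blast
qed

end
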